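(* Let $m\ge 2$, $n=2^m$, and let $\alpha_1,\dots,\alpha_n$ be an enumeration of all elements of $F^m=\{0,1\}^m$. Let $f:F^m\to F^m$ be an $\mathbb{F}_2$-linear operator such that both $f$ and $f+\mathrm{Id}$ are one-to-one. Then the set $$C_{H,f}=\bigcup_{\beta\in F^m}R\big(H^0_{\beta},H^1_{f(\beta)}\big)$$ is a perfect distance $3$ code in $X^n$.
   Context: $F^k=\{0,1\}^k$ is the set of binary words of length $k$, with coordinatewise addition mod $2$. $X^n$ is the set of words of length $n$ over the alphabet $\{0,1,*\}$ containing exactly one symbol $*$, so $|X^n|=n2^{n-1}$. The Hamming distance $d_H$ between two words of length $n$ over $\{0,1,*\}$ is the number of positions in which they differ. A subset $C$ of a finite metric space is a distance $d$ code if $|C|\ge 2$ and $d$ is the minimal distance between two different words of $C$. A distance $3$ code $C\subset X^n$ is perfect if the radius-$1$ balls $\{y\in X^n: d_H(y,z)\le 1\}$, $z\in C$, are pairwise disjoint and cover $X^n$ (each such ball has $n$ elements, so for a distance 3 code this is equivalent to $|C|=2^{n-1}$). For $n=2^m\ge4$ and the enumeration $\alpha_1,\dots,\alpha_n$ of $F^m$, the extended Hamming code is $H=\{x\in F^n:\sum_i x_i=0,\ \sum_i x_i\alpha_i=0^m\}$ (sums mod 2). For $\beta\in F^m$ and $\epsilon\in\{0,1\}$, put $H^\epsilon_\beta=\{x\in F^n:\sum_i x_i=\epsilon,\ \sum_i x_i\alpha_i=\beta\}$; $H^0_\beta$ are the even cosets and $H^1_\beta$ the odd cosets of $H$. If $P$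 is an even coset of an extended Hamming code of length $n$ and $Q$ is an odd coset of a (possibly different) extended Hamming code of length $n$, then for each $p\in P$ there is a unique $q(p)\in Q$ with $d_H(p,q(p))=1$. Let $r(p)\in X^n$ be the word obtained from $p$ by writing $*$ in the unique coordinate where $p$ and $q(p)$ differ. Then $R(P,Q)=\{r(p): p\in P\}\subset X^n$. *)

theory Defs
  imports "HOL-Analysis.Cartesian_Space" "HOL-Library.Z2" "HOL-Library.Disjoint_Sets"
begin

text \<open>
  \<open>F\<^sup>k\<close> is the type \<^typ>\<open>bit ^ 'k\<close> with \<open>k = CARD('k)\<close>. The alphabet \<open>{0,1,*}\<close> is
  \<^typ>\<open>bit option\<close>, where \<^const>\<open>None\<close> stands for the symbol \<open>*\<close>.
\<close>

definition hamming_dist :: "'a ^ 'n \<Rightarrow> 'a ^ 'n \<Rightarrow> nat" where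
  "hamming_dist x y = card {i. x $ i \<noteq> y $ i}"

definition star_words :: "(bit option ^ 'n) set" where
  "star_words = {x. \<exists>!i. x $ i = None}"

definition distance_code :: "('a \<Rightarrow> 'a \<Rightarrow> nat) \<Rightarrow> 'a set \<Rightarrow> nat \<Rightarrow> 'a set \<Rightarrow> bool" where
  "distance_code \<delta> X d C \<longleftrightarrow>
     C \<subseteq> X \<and> card C \<ge> 2 \<and> d = Min {\<delta> x y | x y. x \<in> C \<and> y \<in> C \<and> x \<noteq> y}"

definition star_ball :: "bit option ^ 'n \<Rightarrow> (bit option ^ 'n) set" where
  "star_ball z = {y \<in> star_words. hamming_dist y z \<le> 1}"

definition perfect_distance3_code :: "(bit option ^ 'n) set \<Rightarrow> bool" where
  "perfect_distance3_code C \<longleftrightarrow>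
     distance_code hamming_dist star_words 3 C \<and>
     disjoint_family_on star_ball C \<and> (\<Union>z\<in>C. star_ball z) = star_words"

text \<open>
  \<open>hamming_coset \<alpha> \<epsilon> \<beta>\<close> is \<open>H\<^sup>\<epsilon>\<^sub>\<beta>\<close> for the extended Hamming code
  \<open>H = hamming_coset \<alpha> 0 0\<close> whose coordinates are labelled by the enumeration \<open>\<alpha>\<close>.
\<close>

definition hamming_coset :: "('n \<Rightarrow> bit ^ 'm) \<Rightarrow> bit \<Rightarrow> bit ^ 'm \<Rightarrow> (bit ^ 'n) set" where
  "hamming_coset \<alpha> \<epsilon> \<beta> = {x. (\<Sum>i\<in>UNIV. x $ i) = \<epsilon> \<and> (\<Sum>i\<in>UNIV. x $ i *s \<alpha> i) = \<beta>}"

text \<open>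
  \<open>nearest Q p\<close> is \<open>q(p)\<close>. It is meaningful when \<open>p\<close> lies in an even and \<open>Q\<close> is an odd
  coset of extended Hamming codes: then exactly one element of \<open>Q\<close> is at distance 1 from \<open>p\<close>.
\<close>

definition nearest :: "(bit ^ 'n) set \<Rightarrow> bit ^ 'n \<Rightarrow> bit ^ 'n" where
  "nearest Q p = (THE q. q \<in> Q \<and> hamming_dist p q = 1)"

definition star_at_difference :: "bit ^ 'n \<Rightarrow> bit ^ 'n \<Rightarrow> bit option ^ 'n" where
  "star_at_difference p q = (\<chi> i. if p $ i \<noteq> q $ i then None else Some (p $ i))"

definition R :: "(bit ^ 'n) set \<Rightarrow> (bit ^ 'n) set \<Rightarrow> (bit option ^ 'n) set" where
  "R P Q = (\<lambda>p. star_at_difference p (nearest Q p)) ` P"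

definition C_H :: "('n \<Rightarrow> bit ^ 'm) \<Rightarrow> (bit ^ 'm \<Rightarrow> bit ^ 'm) \<Rightarrow> (bit option ^ 'n) set" where
  "C_H \<alpha> f = (\<Union>\<beta>. R (hamming_coset \<alpha> 0 \<beta>) (hamming_coset \<alpha> 1 (f \<beta>)))"

end

theory Submission
  imports Defs
begin

text \<open>
  A word with one \<open>*\<close>, at position \<open>j\<close>, has exactly one even completion \<open>p\<close>, so such words
  correspond to pairs \<open>(j, p)\<close> with \<open>p\<close> an even binary word. Let \<open>s p = (\<Sum>i. p\<^sub>i \<alpha>\<^sub>i)\<close>. The
  word of an odd coset with syndrome \<open>f (s p)\<close> that is closest to \<open>p\<close> arises by flipping the
  coordinate \<open>j\<close> with \<open>\<alpha>\<^sub>j = s p + f (s p)\<close>. With \<open>g x = f x + x\<close>, the code is therefore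
  the set of all \<open>(j, p)\<close> with \<open>g (s p) = \<alpha>\<^sub>j\<close> (\<open>C_H_eq_star_code\<close>).

  Covering: since a change of the position of \<open>*\<close> costs at least 2, the words within
  distance 1 of \<open>(j, p)\<close> are the pairs \<open>(j, p + e\<^sub>j + e\<^sub>i)\<close>, where \<open>i = j\<close> gives the word
  itself. Such a pair lies in the code if and only if \<open>g (s p + \<alpha>\<^sub>j + \<alpha>\<^sub>i) = \<alpha>\<^sub>j\<close>, which,
  as \<open>g\<close> and \<open>\<alpha>\<close> are bijective, happens for exactly one \<open>i\<close>
  (\<open>star_code_unique_near\<close>). This says that the balls partition the space.

  Distance: let \<open>(j, p)\<close> and \<open>(k, q)\<close> be code words at distance at most 2. If \<open>j = k\<close>, then
  \<open>q = p + e\<^sub>i + e\<^sub>l\<close> for some \<open>i\<close>, \<open>l\<close>, and injectivity of \<open>g\<close> forces \<open>\<alpha>\<^sub>i = \<alpha>\<^sub>l\<close>, hence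
  \<open>q = p\<close>. If \<open>j \<noteq> k\<close>, then \<open>q = p\<close>, so that \<open>\<alpha>\<^sub>j = g (s p) = \<alpha>\<^sub>k\<close>, or
  \<open>q = p + e\<^sub>j + e\<^sub>k\<close>, so that \<open>g (s q) + s q = g (s p) + s p\<close>. But \<open>g x + x = f x\<close> is
  injective, so both are impossible (\<open>star_code_dist_ge_3\<close>). This is where the injectivity of
  \<open>f\<close> enters, whereas covering rests on that of \<open>f + Id\<close>. Distance 3 does occur, between two
  code words with \<open>p = 0\<close> and with \<open>p\<close> of weight 4 (\<open>star_code_dist_3_attained\<close>).
\<close>

section \<open>Binary words and their differences\<close>

instance bit :: finite
proof
  have "(UNIV :: bit set) = {0, 1}"
    using bit.exhaust by auto
  then show "finite (UNIV :: bit set)"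
    by (metis finite.emptyI finite_insert)
qed

lemma bit_vec_add_self [simp]: "(x :: bit ^ 'k) + x = 0"
  by (simp add: vec_eq_iff)

lemma bit_vec_add_self_left [simp]: "(x :: bit ^ 'k) + (x + y) = y"
  by (simp flip: add.assoc)

abbreviation flip :: "'n \<Rightarrow> bit ^ 'n" where
  "flip i \<equiv> axis i 1"

definition differences :: "'a ^ 'n \<Rightarrow> 'a ^ 'n \<Rightarrow> 'n set" where
  "differences x y = {i. x $ i \<noteq> y $ i}"

lemma axis_nth: "axis i c $ k = (if k = i then c else 0)"
  by (simp add: axis_def)

lemma hamming_dist_eq: "hamming_dist x y = card (differences x y)"
  by (simp add: hamming_dist_def differences_def)

text \<open>
  This turns information about the set of differing positions into an equation between words,
  to which parity and syndrome, being additive, can be applied.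
\<close>

lemma eq_add_sum_flips:
  fixes p q :: "bit ^ 'n"
  shows "q = p + (\<Sum>i\<in>differences p q. flip i)"
proof -
  have "q $ k = p $ k + (\<Sum>i\<in>differences p q. flip i $ k)" for k
  proof -
    have "(\<Sum>i\<in>differences p q. flip i $ k) = (if k \<in> differences p q then 1 else (0::bit))"
      by (simp add: axis_def sum.delta)
    then show ?thesis
      by (cases "p $ k"; cases "q $ k") (auto simp: differences_def)
  qed
  then show ?thesis
    by (simp add: vec_eq_iff)
qed

section \<open>Parity and syndrome\<close>

definition parity :: "bit ^ 'n \<Rightarrow> bit" where
  "parity x = (\<Sum>i\<in>UNIV. x $ i)"

definition syndrome :: "('n \<Rightarrow> bit ^ 'm) \<Rightarrow> bit ^ 'n \<Rightarrow> bit ^ 'm" where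
  "syndrome \<alpha> x = (\<Sum>i\<in>UNIV. x $ i *s \<alpha> i)"

lemma hamming_coset_iff:
  "x \<in> hamming_coset \<alpha> \<epsilon> \<beta> \<longleftrightarrow> parity x = \<epsilon> \<and> syndrome \<alpha> x = \<beta>"
  by (simp add: hamming_coset_def parity_def syndrome_def)

lemma parity_add [simp]: "parity (x + y) = parity x + parity y"
  unfolding parity_def vector_add_component by (rule sum.distrib)

lemma parity_zero [simp]: "parity 0 = 0"
  by (simp add: parity_def)

lemma parity_flip [simp]: "parity (flip i) = 1"
  by (simp add: parity_def axis_def)

lemma syndrome_add [simp]: "syndrome \<alpha> (x + y) = syndrome \<alpha> x + syndrome \<alpha> y"
  by (simp only: syndrome_def vector_add_component vector_sadd_rdistrib sum.distrib)

lemma syndrome_zero [simp]: "syndrome \<alpha> 0 = 0"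
  by (simp add: syndrome_def)

lemma syndrome_flip [simp]: "syndrome \<alpha> (flip i) = \<alpha> i"
proof -
  have "syndrome \<alpha> (flip i) = (\<Sum>k\<in>UNIV. if k = i then \<alpha> k else 0)"
    unfolding syndrome_def by (rule sum.cong) (auto simp: axis_def)
  then show ?thesis by simp
qed

lemma even_card_differences:
  fixes p q :: "bit ^ 'n"
  assumes "parity p = parity q"
  shows "even (card (differences p q))"
proof -
  have *: "parity (\<Sum>i\<in>A. flip i) = of_nat (card A)" if "finite A" for A :: "'n set"
    using that by (induction A) (simp_all)
  have "parity q = parity p + of_nat (card (differences p q))"
    using eq_add_sum_flips[of q p] * by (metis finite parity_add)
  then have "(of_nat (card (differences p q)) :: bit) = 0"
    using assms by (metis add_left_cancel add.right_neutral)
  then show ?thesis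
    by (metis even_of_nat_iff dvd_0_right)
qed

text \<open>The bound 3 is as good as 2, because the number of differences is even.\<close>

lemma two_flips:
  fixes p q :: "bit ^ 'n"
  assumes "parity p = parity q" "card (differences p q) \<le> 3"
  shows "\<exists>i k. q = p + flip i + flip k"
proof -
  have "card (differences p q) = 0 \<or> card (differences p q) = 2"
    using even_card_differences[OF assms(1)] assms(2) by presburger
  then show ?thesis
  proof
    assume "card (differences p q) = 0"
    \<comment> \<open>Equal words arise by flipping an arbitrary coordinate twice.\<close>
    then have "q = p + flip undefined + flip undefined"
      using eq_add_sum_flips[of q p] by (simp add: add.assoc)
    then show ?thesis by blast
  next
    assume "card (differences p q) = 2"
    then obtain i k where "differences p q = {i, k}" "i \<noteq> k"
      by (auto simp: card_2_iff)
    then have "q = p + flip i + flip k"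
      using eq_add_sum_flips[of q p] by (simp add: add.assoc)
    then show ?thesis by blast
  qed
qed

section \<open>Words with one star as pairs of a position and an even word\<close>

definition starred :: "'n \<Rightarrow> bit ^ 'n \<Rightarrow> bit option ^ 'n" where
  "starred j p = (\<chi> i. if i = j then None else Some (p $ i))"

lemma starred_nth: "starred j p $ i = (if i = j then None else Some (p $ i))"
  by (simp add: starred_def)

lemma differences_starred:
  "differences (starred j p) (starred k q) =
     (if j = k then differences p q - {j} else differences p q \<union> {j, k})"
  by (auto simp: differences_def starred_nth)

lemma star_words_eq: "star_words = {starred j p | j p. parity p = 0}"
proof (intro set_eqI iffI)
  fix x :: "bit option ^ 'n"
  assume "x \<in> star_words"
  then obtain j where j: "x $ i = None \<longleftrightarrow> i = j" for i
    by (auto simp: star_words_def)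
  define q :: "bit ^ 'n" where "q = (\<chi> i. case x $ i of None \<Rightarrow> 0 | Some b \<Rightarrow> b)"
  have x: "x = starred j q" "x = starred j (q + flip j)"
    using j by (auto simp: vec_eq_iff starred_nth q_def axis_def split: option.splits)
  \<comment> \<open>One of the two ways to fill in the star is even.\<close>
  show "x \<in> {starred j p | j p. parity p = 0}"
  proof (cases "parity q")
    case zero
    with x(1) show ?thesis by blast
  next
    case one
    then have "parity (q + flip j) = 0" by simp
    with x(2) show ?thesis by blast
  qed
qed (auto simp: star_words_def starred_nth split: if_splits)

text \<open>
  Words with stars in different positions differ in both of these positions. If the star stays
  and the visible coordinate \<open>i\<close> changes, then the hidden coordinate \<open>j\<close> has to change with it
  to keep the parity; \<open>i = j\<close> stands for no change.
\<close>

lemma starred_near_iff: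
  assumes "parity p = parity q"
  shows "hamming_dist (starred j p) (starred k q) \<le> 1 \<longleftrightarrow>
           k = j \<and> (\<exists>i. q = p + flip j + flip i)"
proof
  assume near: "hamming_dist (starred j p) (starred k q) \<le> 1"
  have kj: "k = j"
  proof (rule ccontr)
    assume "k \<noteq> j"
    then have "card {j, k} \<le> hamming_dist (starred j p) (starred k q)"
      unfolding hamming_dist_eq differences_starred by (intro card_mono) auto
    with near \<open>k \<noteq> j\<close> show False by simp
  qed
  then have c: "card (differences p q - {j}) \<le> 1"
    using near by (simp add: hamming_dist_eq differences_starred)
  show "k = j \<and> (\<exists>i. q = p + flip j + flip i)"
  proof (cases "j \<in> differences p q")
    case True
    have "card (differences p q) \<noteq> 1"
      using even_card_differences[OF assms] by auto
    then have "card (differences p q - {j}) = 1"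
      using c True card_Suc_Diff1[of "differences p q" j] by simp
    then obtain i where "differences p q - {j} = {i}"
      by (auto simp: card_1_singleton_iff)
    then have "differences p q = {j, i}" "i \<noteq> j"
      using True by auto
    then have "q = p + flip j + flip i"
      using eq_add_sum_flips[of q p] by (simp add: add.assoc)
    with kj show ?thesis by blast
  next
    case False
    then have "card (differences p q) \<le> 1"
      using c by simp
    then have "card (differences p q) = 0"
      using even_card_differences[OF assms] by presburger
    then have "q = p + flip j + flip j"
      using eq_add_sum_flips[of q p] by (simp add: add.assoc)
    with kj show ?thesis by blast
  qed
next
  assume "k = j \<and> (\<exists>i. q = p + flip j + flip i)"
  then obtain i where "k = j" "q = p + flip j + flip i" by blast
  then have "differences (starred j p) (starred k q) \<subseteq> {i}"
    by (simp add: differences_starred) (auto simp: differences_def axis_nth)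
  then have "hamming_dist (starred j p) (starred k q) \<le> card {i}"
    unfolding hamming_dist_eq by (intro card_mono) auto
  then show "hamming_dist (starred j p) (starred k q) \<le> 1" by simp
qed

text \<open>
  For equal positions, at most two visible coordinates and the hidden one differ, so evenness
  leaves at most two differences. For distinct positions, these account already for distance 2,
  so the words agree elsewhere, and by parity they differ in both positions or in none.
\<close>

lemma starred_dist_le_2:
  assumes "parity p = parity q" "hamming_dist (starred j p) (starred k q) \<le> 2"
  shows "if j = k then \<exists>i l. q = p + flip i + flip l else q = p \<or> q = p + flip j + flip k"
proof (cases "j = k")
  case True
  then have "card (differences p q - {j}) \<le> 2"
    using assms(2) by (simp add: hamming_dist_eq differences_starred)
  moreover have "card (differences p q) \<le> Suc (card (differences p q - {j}))"
    by (metis card_Suc_Diff1 card_Diff_singleton_if finite le_SucI order_refl)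
  ultimately show ?thesis
    using True two_flips[OF assms(1)] by simp
next
  case False
  have "differences p q \<union> {j, k} = {j, k}"
    using assms(2) False
    by (intro card_seteq[symmetric]) (auto simp: hamming_dist_eq differences_starred)
  then have "differences p q \<subseteq> {j, k}" by blast
  then consider "differences p q = {}" | "differences p q = {j}" | "differences p q = {k}"
    | "differences p q = {j, k}"
    by blast
  then show ?thesis
    using even_card_differences[OF assms(1)] eq_add_sum_flips[of q p] False
    by cases (simp_all add: add.assoc)
qed

section \<open>The code in terms of syndromes\<close>

text \<open>
  This describes \<open>C_H \<alpha> f\<close> for \<open>g x = f x + x\<close>. The map \<open>g\<close> rather than \<open>f\<close> is the
  parameter, since covering comes down to solving an equation \<open>g x = \<alpha> j\<close>.
\<close>

definition star_code ::
    "('n \<Rightarrow> bit ^ 'm) \<Rightarrow> (bit ^ 'm \<Rightarrow> bit ^ 'm) \<Rightarrow> (bit option ^ 'n) set" where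
  "star_code \<alpha> g = {starred j p | j p. parity p = 0 \<and> g (syndrome \<alpha> p) = \<alpha> j}"

text \<open>
  Flipping coordinate \<open>i\<close> adds \<open>\<alpha> i\<close> to the syndrome, so the target syndrome determines the
  flipped coordinate.
\<close>

lemma nearest_hamming_coset:
  fixes \<alpha> :: "'n::finite \<Rightarrow> bit ^ 'm"
  assumes "inj \<alpha>" "parity p = 0" "\<alpha> i = syndrome \<alpha> p + \<beta>"
  shows "nearest (hamming_coset \<alpha> 1 \<beta>) p = p + flip i"
  unfolding nearest_def
proof (rule the_equality)
  have "differences p (p + flip i) = {i}"
    by (auto simp: differences_def axis_def split: if_splits)
  then show "p + flip i \<in> hamming_coset \<alpha> 1 \<beta> \<and> hamming_dist p (p + flip i) = 1"
    using assms by (simp add: hamming_coset_iff hamming_dist_eq)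
next
  fix q assume q: "q \<in> hamming_coset \<alpha> 1 \<beta> \<and> hamming_dist p q = 1"
  then obtain k where "differences p q = {k}"
    by (auto simp: hamming_dist_eq card_1_singleton_iff)
  then have k: "q = p + flip k"
    using eq_add_sum_flips[of q p] by simp
  then have "syndrome \<alpha> p + \<alpha> k = \<beta>"
    using q by (simp add: hamming_coset_iff)
  then have "\<alpha> k = \<alpha> i"
    using assms(3) by auto
  then show "q = p + flip i"
    using k assms(1) by (simp add: inj_eq)
qed

lemma C_H_eq_star_code:
  assumes "bij \<alpha>"
  shows "C_H \<alpha> f = star_code \<alpha> (\<lambda>x. f x + x)"
proof -
  have r: "star_at_difference p (nearest (hamming_coset \<alpha> 1 (f (syndrome \<alpha> p))) p) = starred i p"
    if "parity p = 0" "\<alpha> i = f (syndrome \<alpha> p) + syndrome \<alpha> p" for p i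
  proof -
    have "nearest (hamming_coset \<alpha> 1 (f (syndrome \<alpha> p))) p = p + flip i"
      using that bij_is_inj[OF assms] by (intro nearest_hamming_coset) (auto simp: add.commute)
    then show ?thesis
      by (simp add: star_at_difference_def starred_def vec_eq_iff axis_def)
  qed
  define star where "star p = inv \<alpha> (f (syndrome \<alpha> p) + syndrome \<alpha> p)" for p
  have star: "f (syndrome \<alpha> p) + syndrome \<alpha> p = \<alpha> i \<longleftrightarrow> i = star p" for p i
    unfolding star_def using bij_inv_eq_iff[OF assms] by metis
  have "star_at_difference p (nearest (hamming_coset \<alpha> 1 (f \<beta>)) p) = starred (star p) p"
    if "p \<in> hamming_coset \<alpha> 0 \<beta>" for p \<beta>
    using r[of p "star p"] star[of p "star p"] that by (simp only: hamming_coset_iff) auto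
  then have "R (hamming_coset \<alpha> 0 \<beta>) (hamming_coset \<alpha> 1 (f \<beta>)) =
      (\<lambda>p. starred (star p) p) ` hamming_coset \<alpha> 0 \<beta>" for \<beta>
    unfolding R_def by (intro image_cong) auto
  moreover have "(\<Union>\<beta>. hamming_coset \<alpha> 0 \<beta>) = {p. parity p = 0}"
    by (auto simp: hamming_coset_iff)
  ultimately have "C_H \<alpha> f = (\<lambda>p. starred (star p) p) ` {p. parity p = 0}"
    unfolding C_H_def by (simp flip: image_UN)
  then show ?thesis
    unfolding star_code_def star by auto
qed

section \<open>Covering\<close>

text \<open>
  Moving within the ball around \<open>y\<close> adds \<open>\<alpha> j + \<alpha> i\<close> to the syndrome of the even completion,
  with \<open>j\<close> fixed. So each syndrome is reached exactly once, in particular the only one that \<open>g\<close>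
  maps to \<open>\<alpha> j\<close>.
\<close>

lemma star_code_unique_near:
  fixes \<alpha> :: "'n::finite \<Rightarrow> bit ^ 'm"
  assumes "bij \<alpha>" "bij g" "y \<in> star_words"
  shows "\<exists>!z. z \<in> star_code \<alpha> g \<and> hamming_dist y z \<le> 1"
proof -
  obtain j p where y: "y = starred j p" and p: "parity p = 0"
    using assms(3) by (auto simp: star_words_eq)
  have near: "z \<in> star_code \<alpha> g \<and> hamming_dist y z \<le> 1 \<longleftrightarrow>
      (\<exists>i. z = starred j (p + flip j + flip i) \<and> g (syndrome \<alpha> p + \<alpha> j + \<alpha> i) = \<alpha> j)" for z
    unfolding star_code_def y using p starred_near_iff[of p _ j]
    by fastforce
  have "\<exists>!i. g (syndrome \<alpha> p + \<alpha> j + \<alpha> i) = \<alpha> j"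
  proof -
    obtain x where x: "g x = \<alpha> j" using bij_is_surj[OF assms(2)] by (metis surjD)
    obtain i where i: "\<alpha> i = syndrome \<alpha> p + \<alpha> j + x"
      using bij_is_surj[OF assms(1)] by (metis surjD)
    have "g (syndrome \<alpha> p + \<alpha> j + \<alpha> i) = \<alpha> j" using i x by (simp only: bit_vec_add_self_left)
    moreover have "k = l" if "g (syndrome \<alpha> p + \<alpha> j + \<alpha> k) = \<alpha> j" "g (syndrome \<alpha> p + \<alpha> j + \<alpha> l) = \<alpha> j" for k l
      using that bij_is_inj[OF assms(1)] bij_is_inj[OF assms(2)]
      by (metis add_left_cancel inj_eq)
    ultimately show ?thesis by blast
  qed
  then show ?thesis
    unfolding near by auto
qed

section \<open>Minimal distance\<close>

text \<open>
  Injectivity of \<open>g\<close> separates code words with the star in the same position; injectivity of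
  \<open>g + Id\<close> separates those with stars in different positions \<open>j\<close> and \<open>k\<close>, as adding \<open>\<alpha> j + \<alpha> k\<close>
  to both the syndrome and its image under \<open>g\<close> does not change the value of \<open>g x + x\<close>.
\<close>

lemma star_code_dist_ge_3:
  assumes \<alpha>: "inj \<alpha>" and g: "inj g"
    and g_id: "inj (\<lambda>x. g x + x)"
    and z: "z \<in> star_code \<alpha> g" and w: "w \<in> star_code \<alpha> g" and "z \<noteq> w"
  shows "hamming_dist z w \<ge> 3"
proof (rule ccontr)
  assume "\<not> hamming_dist z w \<ge> 3"
  then have "hamming_dist z w \<le> 2" by simp
  obtain j p where zp: "z = starred j p" "parity p = 0" "g (syndrome \<alpha> p) = \<alpha> j"
    using z by (auto simp: star_code_def)
  obtain k q where wq: "w = starred k q" "parity q = 0" "g (syndrome \<alpha> q) = \<alpha> k"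
    using w by (auto simp: star_code_def)
  have dist: "if j = k then \<exists>i l. q = p + flip i + flip l else q = p \<or> q = p + flip j + flip k"
    using \<open>hamming_dist z w \<le> 2\<close> zp wq by (intro starred_dist_le_2) auto
  show False
  proof (cases "j = k")
    case True
    then obtain i l where q: "q = p + flip i + flip l" using dist by auto
    have "syndrome \<alpha> p = syndrome \<alpha> q"
      using zp wq True g by (metis inj_eq)
    then have "\<alpha> i = \<alpha> l"
      unfolding q by (simp add: add.assoc) (metis bit_vec_add_self_left add.right_neutral)
    then have "q = p" using \<alpha> q by (simp add: inj_eq add.assoc)
    with True zp wq \<open>z \<noteq> w\<close> show False by simp
  next
    case False
    then have "\<alpha> j \<noteq> \<alpha> k" using \<alpha> by (simp add: inj_eq)
    then have "q \<noteq> p" using zp wq by auto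
    then have "syndrome \<alpha> q = syndrome \<alpha> p + \<alpha> j + \<alpha> k"
      using dist False by simp
    then have "g (syndrome \<alpha> q) + syndrome \<alpha> q = g (syndrome \<alpha> p) + syndrome \<alpha> p"
      using zp wq by (simp add: ac_simps)
    then have "syndrome \<alpha> q = syndrome \<alpha> p" using g_id by (auto dest: injD)
    then show False using zp wq \<open>\<alpha> j \<noteq> \<alpha> k\<close> by simp
  qed
qed

text \<open>
  Put the star at the position \<open>j\<close> with \<open>\<alpha> j = 0\<close> and choose \<open>i\<close> with
  \<open>\<alpha> i = \<alpha> a + \<alpha> b\<close>. The word with ones in the positions \<open>a\<close>, \<open>b\<close>, \<open>i\<close>, \<open>j\<close> lies in the
  extended Hamming code, as does the zero word, and the star hides one of the four differences.
\<close>

lemma star_code_dist_3_attained: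
  fixes \<alpha> :: "'n::finite \<Rightarrow> bit ^ 'm"
  assumes "bij \<alpha>" "g 0 = 0" "CARD('n) \<ge> 3"
  obtains z w where "z \<in> star_code \<alpha> g" "w \<in> star_code \<alpha> g" "z \<noteq> w" "hamming_dist z w \<le> 3"
proof -
  note inj = bij_is_inj[OF assms(1)]
  obtain j where j: "\<alpha> j = 0" using bij_is_surj[OF assms(1)] by (metis surjD)
  have "card (UNIV - {j}) \<ge> 2" using assms(3) by simp
  then obtain T where "T \<subseteq> UNIV - {j}" "card T = 2"
    by (rule obtain_subset_with_card_n)
  then obtain a b where ab: "a \<noteq> b" "a \<noteq> j" "b \<noteq> j"
    by (auto simp: card_2_iff)
  obtain i where i: "\<alpha> i = \<alpha> a + \<alpha> b" using bij_is_surj[OF assms(1)] by (metis surjD)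
  have "\<alpha> b \<noteq> 0" using ab(3) j inj by (metis inj_eq)
  then have "a \<noteq> i" using i by auto
  define p where "p = flip a + flip b + flip i + flip j"
  have "starred j 0 \<in> star_code \<alpha> g"
    unfolding star_code_def using assms(2) j by (auto intro!: exI[of _ j] exI[of _ 0])
  moreover have "starred j p \<in> star_code \<alpha> g"
  proof -
    have "syndrome \<alpha> p = (\<alpha> a + \<alpha> b) + (\<alpha> a + \<alpha> b)"
      using i j by (simp only: p_def syndrome_add syndrome_flip add_0_right)
    then have "syndrome \<alpha> p = 0" "parity p = 0"
      by (simp_all only: bit_vec_add_self) (simp add: p_def)
    then show ?thesis
      unfolding star_code_def using assms(2) j by (intro CollectI exI[of _ j] exI[of _ p]) simp
  qed
  moreover have "starred j 0 \<noteq> starred j p"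
  proof -
    have "starred j 0 $ a \<noteq> starred j p $ a"
      using ab \<open>a \<noteq> i\<close> by (auto simp: starred_nth p_def axis_def)
    then show ?thesis by auto
  qed
  moreover have "hamming_dist (starred j 0) (starred j p) \<le> 3"
  proof -
    have "differences (starred j 0) (starred j p) \<subseteq> {a, b, i}"
      by (auto simp: differences_def starred_nth p_def axis_def split: if_splits)
    then have "hamming_dist (starred j 0) (starred j p) \<le> card {a, b, i}"
      unfolding hamming_dist_eq by (intro card_mono) auto
    also have "\<dots> \<le> 3" by (simp add: card_insert_if)
    finally show ?thesis .
  qed
  ultimately show ?thesis using that by blast
qed

section \<open>Perfection\<close>

theorem theorem3p5:
  fixes \<alpha> :: "'n::finite \<Rightarrow> bit ^ 'm::finite"
    and f :: "bit ^ 'm \<Rightarrow> bit ^ 'm"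
  assumes "CARD('m) \<ge> 2"
    and "CARD('n) = 2 ^ CARD('m)"
    and "bij \<alpha>"
    and "Vector_Spaces.linear (*s) (*s) f"
    and "inj f"
    and "inj (\<lambda>x. f x + x)"
  shows "perfect_distance3_code (C_H \<alpha> f)"
proof -
  define g where "g = (\<lambda>x. f x + x)"
  define C where "C = star_code \<alpha> g"
  have C_H: "C_H \<alpha> f = C"
    using C_H_eq_star_code[OF \<open>bij \<alpha>\<close>] by (simp add: C_def g_def)
  have "bij g"
    using \<open>inj (\<lambda>x. f x + x)\<close> finite_UNIV_inj_surj[OF finite, of g]
    by (simp add: bij_def g_def)
  have "g 0 = 0"
    using vec.linear_0[OF assms(4)] by (simp add: g_def)
  have "(2::nat) ^ 2 \<le> 2 ^ CARD('m)"
    using assms(1) by (intro power_increasing) auto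
  then have "CARD('n) \<ge> 3" using assms(2) by simp
  have "inj (\<lambda>x. g x + x)"
    using \<open>inj f\<close> by (simp add: g_def add.assoc)
  have sub: "C \<subseteq> star_words"
    by (auto simp: C_def star_code_def star_words_eq)
  have lower: "hamming_dist z w \<ge> 3" if "z \<in> C" "w \<in> C" "z \<noteq> w" for z w
    using star_code_dist_ge_3[OF bij_is_inj[OF \<open>bij \<alpha>\<close>] bij_is_inj[OF \<open>bij g\<close>]
        \<open>inj (\<lambda>x. g x + x)\<close>] that
    unfolding C_def by blast
  obtain z w where zw: "z \<in> C" "w \<in> C" "z \<noteq> w" "hamming_dist z w \<le> 3"
    using star_code_dist_3_attained[of \<alpha> g, OF \<open>bij \<alpha>\<close> \<open>g 0 = 0\<close> \<open>CARD('n) \<ge> 3\<close>] unfolding C_def by blast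
  have "card C \<ge> 2"
    using card_mono[of C "{z, w}"] zw by simp
  moreover have "Min {hamming_dist x y | x y. x \<in> C \<and> y \<in> C \<and> x \<noteq> y} = 3"
  proof (rule Min_eqI)
    have "{hamming_dist x y | x y. x \<in> C \<and> y \<in> C \<and> x \<noteq> y} \<subseteq> (\<lambda>(x, y). hamming_dist x y) ` (C \<times> C)"
      by auto
    then show "finite {hamming_dist x y | x y. x \<in> C \<and> y \<in> C \<and> x \<noteq> y}"
      by (rule finite_subset) simp
    have "hamming_dist z w = 3" using lower[OF zw(1-3)] zw(4) by simp
    then show "3 \<in> {hamming_dist x y | x y. x \<in> C \<and> y \<in> C \<and> x \<noteq> y}"
      using zw by (metis (mono_tags, lifting) mem_Collect_eq)
  qed (use lower in auto)
  ultimately have "distance_code hamming_dist star_words 3 C"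
    using sub by (simp add: distance_code_def)
  moreover have cover: "\<exists>!z. z \<in> C \<and> y \<in> star_ball z" if "y \<in> star_words" for y
    using star_code_unique_near[OF \<open>bij \<alpha>\<close> \<open>bij g\<close> that] that by (simp add: C_def star_ball_def)
  then have "disjoint_family_on star_ball C"
    unfolding disjoint_family_on_def star_ball_def by blast
  moreover have "(\<Union>z\<in>C. star_ball z) = star_words"
    using cover unfolding star_ball_def by blast
  ultimately show ?thesis
    by (simp add: perfect_distance3_code_def C_H)
qed

end
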